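(* Let $n_1,n_2,n_3\in\mathbb{N}_0$, let $\alpha,\beta,\gamma,\delta,a,b,\xi$ be real parameters, and put $n=n_1+n_2+n_3$, $e=\alpha+\beta+\gamma+\delta+a+b$. Assume that no Gamma function below is evaluated at a non-positive integer. Then $$\begin{aligned}P_{n_1,n_2,n_3}^{(\alpha,\beta,\gamma,\delta,a,b)}(x,y,z)=\sum_{m=0}^{n_1}&\frac{(-1)^m(2n-2m+e-\alpha+\xi+3)\,\Gamma(n+n_2+n_3+e-\alpha+3)\,(\alpha-\xi)_m}{\Gamma(n+n_2+n_3+e+3)\,\Gamma(2n-m+e-\alpha+\xi+4)}\\&\times\frac{\Gamma(2n-m+e+3)\,\Gamma(n+n_2+n_3-m+e-\alpha+\xi+3)}{m!\,\Gamma(n+n_2+n_3-m+e-\alpha+3)}\,P_{n_1-m,n_2,n_3}^{(\xi,\beta,\gamma,\delta,a,b)}(x,y,z).\end{aligned}$$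
   Context: Jacobi polynomials: for $n\in\mathbb{N}_0=\{0,1,2,\dots\}$ and real $p,q$, $$P_n^{(p,q)}(t)=\frac{(-1)^n}{2^n n!}(1-t)^{-p}(1+t)^{-q}\frac{d^n}{dt^n}\left\{(1-t)^{n+p}(1+t)^{n+q}\right\}$$ (a polynomial in $t$). Points $(x,y,z)$ range over the simplex $\mathbb{T}^3=\{(x,y,z)\in\mathbb{R}^3: x,y,z>0,\ 1-x-y-z>0\}$. Six-parameter polynomials: for $n_1,n_2,n_3\in\mathbb{N}_0$, $$P_{n_1,n_2,n_3}^{(\alpha,\beta,\gamma,\delta,a,b)}(x,y,z)=P_{n_1}^{(\beta+\gamma+\delta+a+b+2n_2+2n_3+2,\,\alpha)}(2x-1)\,(1-x)^{n_2}\,P_{n_2}^{(\gamma+\delta+2n_3+b+1,\,\beta)}\!\left(\tfrac{2y}{1-x}-1\right)(1-x-y)^{n_3}\,P_{n_3}^{(\delta,\gamma)}\!\left(\tfrac{2z}{1-x-y}-1\right).$$ Pochhammer symbol: $(\lambda)_0=1$ and $(\lambda)_m=\lambda(\lambda+1)\cdots(\lambda+m-1)$ for $m\ge1$. *)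

theory Defs
  imports "HOL-Analysis.Analysis"
begin

text \<open>
  Jacobi polynomials with arbitrary real parameters, by Rodrigues' formula. With real exponents the
  formula makes sense, and agrees with a polynomial in \<open>t\<close>, for \<open>-1 < t < 1\<close> only; the three
  arguments occurring in \<open>P3\<close> below lie in that interval whenever \<open>(x, y, z) \<in> simplex3\<close>.
\<close>

definition jacobi_P :: "nat \<Rightarrow> real \<Rightarrow> real \<Rightarrow> real \<Rightarrow> real" where
  "jacobi_P n p q t =
     (-1) ^ n / (2 ^ n * fact n) * (1 - t) powr (- p) * (1 + t) powr (- q) *
     (deriv ^^ n) (\<lambda>s. (1 - s) powr (real n + p) * (1 + s) powr (real n + q)) t"

definition simplex3 :: "(real \<times> real \<times> real) set" where
  "simplex3 = {(x, y, z). x > 0 \<and> y > 0 \<and> z > 0 \<and> 1 - x - y - z > 0}"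

definition P3 ::
  "nat \<Rightarrow> nat \<Rightarrow> nat \<Rightarrow> real \<Rightarrow> real \<Rightarrow> real \<Rightarrow> real \<Rightarrow> real \<Rightarrow> real \<Rightarrow> real \<Rightarrow> real \<Rightarrow> real \<Rightarrow> real" where
  "P3 n1 n2 n3 \<alpha> \<beta> \<gamma> \<delta> a b x y z =
     jacobi_P n1 (\<beta> + \<gamma> + \<delta> + a + b + 2 * real n2 + 2 * real n3 + 2) \<alpha> (2 * x - 1) *
     (1 - x) ^ n2 *
     jacobi_P n2 (\<gamma> + \<delta> + 2 * real n3 + b + 1) \<beta> (2 * y / (1 - x) - 1) *
     (1 - x - y) ^ n3 *
     jacobi_P n3 \<delta> \<gamma> (2 * z / (1 - x - y) - 1)"

end

theory Submission
  imports Defs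
begin

text \<open>
  In \<open>P3\<close> the parameter \<open>\<alpha>\<close> enters only through the second upper index of the first Jacobi factor,
  and neither the first upper index \<open>p\<close> of that factor nor the other factors involve \<open>n1\<close> or \<open>\<alpha>\<close>. So the
  identity is the one-variable connection formula, expanding \<open>P_N^(p,\<alpha>)\<close> in the polynomials
  \<open>P_k^(p,\<xi>)\<close>, multiplied by the common remaining factors; this is \<open>jacobi_P_connection\<close>.

  All these polynomials share the endpoint \<open>t = 1\<close> and its index \<open>p\<close>, so they are compared in powers of
  \<open>(t - 1) / 2\<close>, where the coefficients are products of Pochhammer symbols (\<open>jacobi_P_eq_sum\<close>, obtained from
  Rodrigues' formula by induction on the order of the derivative). The coefficient of the \<open>k\<close>-th power on
  the right is the one on the left times a terminating very-well-poised series in which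
  \<open>r = N - k\<close> plays the role of the degree and whose value is 1. That evaluation,
  \<open>very_well_poised_sum\<close>, is proved by the Wilf-Zeilberger method: the difference of the summands for
  \<open>r + 1\<close> and \<open>r\<close> telescopes in \<open>m\<close>. The Gamma functions of the final formula are only a way to write the
  Pochhammer symbols of \<open>jacobi_P_connection_pochhammer\<close>.
\<close>

section \<open>Jacobi polynomials in powers of (t - 1) / 2\<close>

text \<open>
  With \<open>u = (1 - t) / 2\<close>, the polynomial with coefficients \<open>(-1)^k * rodrigues_coeff A B j k\<close> in \<open>u\<close> is
  \<open>u^(j-A) * (1-u)^(j-B)\<close> times the \<open>j\<close>-th derivative of \<open>u^A * (1-u)^B\<close>; up to a factor it is the
  hypergeometric polynomial \<open>2F1(-j, A + B - j + 1; A - j + 1; u)\<close>. Pulling the quotient of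
  Pochhammer symbols together to \<open>pochhammer (A - j + 1 + k) (j - k)\<close> keeps it meaningful when
  \<open>A - j + 1\<close> is a non-positive integer.
\<close>

definition rodrigues_coeff :: "real \<Rightarrow> real \<Rightarrow> nat \<Rightarrow> nat \<Rightarrow> real" where
  "rodrigues_coeff A B j k =
     real (j choose k) * pochhammer (A + B - real j + 1) k * pochhammer (A - real j + 1 + real k) (j - k)"

lemma rodrigues_coeff_Suc_0: "rodrigues_coeff A B (Suc j) 0 = (A - real j) * rodrigues_coeff A B j 0"
  by (simp add: rodrigues_coeff_def pochhammer_rec algebra_simps)

text \<open>
  After the common Pochhammer factors are removed, Pascal's rule and the absorption identity
  \<open>(k + 1) * (j choose (k + 1)) = (j - k) * (j choose k)\<close> are all that this recurrence uses.
\<close>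

lemma rodrigues_coeff_Suc_Suc:
  assumes "k \<le> j"
  shows "rodrigues_coeff A B (Suc j) (Suc k) =
    (A - real j + real (Suc k)) * rodrigues_coeff A B j (Suc k)
      + (A + B - 2 * real j + real k) * rodrigues_coeff A B j k"
proof -
  define S where "S = A + B - real j"
  define W where "W = pochhammer (A - real j + 1 + real k) (j - k)"
  define V where "V = pochhammer (S + 1) k"
  have absorb: "real (Suc k) * real (j choose Suc k) = (real j - real k) * real (j choose k)"
    using binomial_absorb_comp[of j k] binomial_absorption[of k j] assms
    by (metis of_nat_diff of_nat_mult)
  have lhs: "rodrigues_coeff A B (Suc j) (Suc k)
      = (real (j choose k) + real (j choose Suc k)) * (S * V) * W"
    by (simp add: rodrigues_coeff_def S_def V_def W_def pochhammer_rec algebra_simps)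
  have second: "rodrigues_coeff A B j k = real (j choose k) * V * W"
    by (simp add: rodrigues_coeff_def S_def V_def W_def)
  have first: "(A - real j + real (Suc k)) * rodrigues_coeff A B j (Suc k)
      = real (j choose Suc k) * (V * (S + 1 + real k)) * W"
  proof (cases "k < j")
    case True
    then have "j - k = Suc (j - Suc k)" by simp
    define W' where "W' = pochhammer (A - real j + 1 + real (Suc k)) (j - Suc k)"
    have W: "W = (A - real j + real (Suc k)) * W'"
      unfolding W_def W'_def \<open>j - k = Suc (j - Suc k)\<close> pochhammer_rec by (simp add: add_ac diff_add_eq)
    have "rodrigues_coeff A B j (Suc k) = real (j choose Suc k) * (V * (S + 1 + real k)) * W'"
      by (simp add: rodrigues_coeff_def S_def V_def W'_def pochhammer_Suc)
    then show ?thesis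
      by (simp add: W)
  qed (simp add: rodrigues_coeff_def)
  have "(real (j choose k) + real (j choose Suc k)) * S
      = real (j choose Suc k) * (S + 1 + real k) + (S - real j + real k) * real (j choose k)"
    using absorb by (simp add: algebra_simps)
  then have "(real (j choose k) + real (j choose Suc k)) * S * (V * W)
      = (real (j choose Suc k) * (S + 1 + real k) + (S - real j + real k) * real (j choose k)) * (V * W)"
    by simp
  then show ?thesis
    unfolding lhs first second by (simp add: S_def algebra_simps)
qed

text \<open>
  Differentiating \<open>(1 - t)^(A-j) * (1 + t)^(B-j) * Q\<close>, with \<open>w = (t - 1) / 2\<close>, and removing the weight
  with exponents lowered by one turns \<open>Q\<close> into \<open>(A - j)(1 + w) Q + (B - j) w Q + w (1 + w) dQ/dw\<close>
  up to the factor -2. On the monomial \<open>w^k\<close> this operator is multiplication by the bracket below.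
\<close>

lemma rodrigues_poly_Suc:
  fixes w :: real
  shows "(\<Sum>k\<le>Suc j. rodrigues_coeff A B (Suc j) k * w ^ k) =
    (\<Sum>k\<le>j. rodrigues_coeff A B j k *
       ((A - real j) * (1 + w) + (B - real j) * w + real k * (1 + w)) * w ^ k)"
proof -
  let ?c = "rodrigues_coeff A B"
  have top: "?c j (Suc j) = 0"
    by (simp add: rodrigues_coeff_def)
  have "(\<Sum>k\<le>Suc j. ?c (Suc j) k * w ^ k) =
      ?c (Suc j) 0 + (\<Sum>k\<le>j. ?c (Suc j) (Suc k) * w ^ Suc k)"
    by (subst sum.atMost_Suc_shift) simp
  also have "(\<Sum>k\<le>j. ?c (Suc j) (Suc k) * w ^ Suc k) =
      (\<Sum>k\<le>j. (A - real j + real (Suc k)) * ?c j (Suc k) * w ^ Suc k)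
      + (\<Sum>k\<le>j. (A + B - 2 * real j + real k) * ?c j k * w ^ Suc k)"
    unfolding sum.distrib[symmetric]
    by (intro sum.cong refl) (simp add: rodrigues_coeff_Suc_Suc algebra_simps)
  also have "?c (Suc j) 0 + (\<dots>) = 
      (\<Sum>k\<le>Suc j. (A - real j + real k) * ?c j k * w ^ k)
      + (\<Sum>k\<le>j. (A + B - 2 * real j + real k) * ?c j k * w ^ Suc k)"
    by (simp add: sum.atMost_Suc_shift[of _ j] rodrigues_coeff_Suc_0 del: sum.atMost_Suc)
  also have "\<dots> = (\<Sum>k\<le>j. (A - real j + real k) * ?c j k * w ^ k)
      + (\<Sum>k\<le>j. (A + B - 2 * real j + real k) * ?c j k * w ^ Suc k)"
    by (simp add: top)
  also have "\<dots> = (\<Sum>k\<le>j. ?c j k *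
       ((A - real j) * (1 + w) + (B - real j) * w + real k * (1 + w)) * w ^ k)"
    unfolding sum.distrib[symmetric]
    by (intro sum.cong refl) (simp add: algebra_simps)
  finally show ?thesis .
qed

lemma higher_deriv_jacobi_weight:
  fixes A B t :: real
  assumes "-1 < t" "t < 1"
  shows "(deriv ^^ j) (\<lambda>s. (1 - s) powr A * (1 + s) powr B) t =
    (-2) ^ j * ((1 - t) powr (A - real j) * (1 + t) powr (B - real j)) *
      (\<Sum>k\<le>j. rodrigues_coeff A B j k * ((t - 1) / 2) ^ k)"
  using assms
proof (induction j arbitrary: t)
  case 0
  then show ?case by (simp add: rodrigues_coeff_def)
next
  case (Suc j)
  let ?f = "\<lambda>s. (1 - s) powr A * (1 + s) powr B"
  let ?Q = "\<lambda>j t. \<Sum>k\<le>j. rodrigues_coeff A B j k * ((t - 1) / 2) ^ k"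
  let ?g = "\<lambda>t. (-2) ^ j * ((1 - t) powr (A - real j) * (1 + t) powr (B - real j)) * ?Q j t"
  define w where "w = (t - 1) / 2"
  have t: "1 - t = -2 * w" "1 + t = 2 * (1 + w)" by (simp_all add: w_def field_simps)
  define U where "U = (1 - t) powr (A - real (Suc j))"
  define V where "V = (1 + t) powr (B - real (Suc j))"
  define Q' where "Q' = (\<Sum>k\<le>j. rodrigues_coeff A B j k * (real k * w ^ (k - 1) / 2))"
  have U: "(1 - t) powr (A - real j) = U * (1 - t)" and V: "(1 + t) powr (B - real j) = V * (1 + t)"
    using Suc.prems powr_add[of "1 - t" "A - real (Suc j)" 1] powr_add[of "1 + t" "B - real (Suc j)" 1]
    by (simp_all add: U_def V_def)
  have dU: "((\<lambda>t. (1 - t) powr (A - real j)) has_field_derivative - (A - real j) * U) (at t)"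
    using Suc.prems by (auto intro!: derivative_eq_intros simp: U_def algebra_simps)
  have dV: "((\<lambda>t. (1 + t) powr (B - real j)) has_field_derivative (B - real j) * V) (at t)"
    using Suc.prems by (auto intro!: derivative_eq_intros simp: V_def algebra_simps)
  have dQ: "(?Q j has_field_derivative Q') (at t)"
    unfolding Q'_def w_def
    by (rule DERIV_sum) (auto intro!: derivative_eq_intros)
  have wQ': "2 * w * Q' = (\<Sum>k\<le>j. rodrigues_coeff A B j k * (real k * w ^ k))"
    unfolding Q'_def sum_distrib_left
  proof (intro sum.cong refl)
    fix k show "2 * w * (rodrigues_coeff A B j k * (real k * w ^ (k - 1) / 2)) =
        rodrigues_coeff A B j k * (real k * w ^ k)"
      by (cases k) auto
  qed
  have "(?g has_field_derivative
      (-2) ^ j * ((- (A - real j) * U) * (V * (1 + t)) + (U * (1 - t)) * ((B - real j) * V)) * ?Q j t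
      + (-2) ^ j * ((U * (1 - t)) * (V * (1 + t))) * Q') (at t)"
    by (rule DERIV_cong[OF DERIV_mult[OF DERIV_cmult[OF DERIV_mult[OF dU dV]] dQ]])
       (simp add: U V mult_ac)
  also have "(-2) ^ j * ((- (A - real j) * U) * (V * (1 + t)) + (U * (1 - t)) * ((B - real j) * V)) * ?Q j t
      + (-2) ^ j * ((U * (1 - t)) * (V * (1 + t))) * Q'
      = (-2) ^ Suc j * (U * V) * (((A - real j) * (1 + w) + (B - real j) * w) * ?Q j t
          + (1 + w) * (2 * w * Q'))"
    unfolding t by (simp add: algebra_simps)
  also have "((A - real j) * (1 + w) + (B - real j) * w) * ?Q j t + (1 + w) * (2 * w * Q') = ?Q (Suc j) t"
    unfolding wQ' rodrigues_poly_Suc sum_distrib_left sum.distrib[symmetric] w_def[symmetric]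
    by (intro sum.cong refl) (simp add: algebra_simps)
  finally have "(?g has_field_derivative (-2) ^ Suc j * (U * V) * ?Q (Suc j) t) (at t)" .
  then have "((deriv ^^ j) ?f has_field_derivative (-2) ^ Suc j * (U * V) * ?Q (Suc j) t) (at t)"
    by (rule has_field_derivative_transform_within_open[where S = "{-1<..<1}"])
       (use Suc in auto)
  then show ?case
    by (simp add: DERIV_imp_deriv U_def V_def)
qed

lemma jacobi_P_eq_sum:
  assumes "-1 < t" "t < 1"
  shows "jacobi_P n p q t =
    (\<Sum>k\<le>n. real (n choose k) * pochhammer (real n + p + q + 1) k * pochhammer (p + 1 + real k) (n - k)
        / fact n * ((t - 1) / 2) ^ k)"
proof -
  let ?Q = "\<Sum>k\<le>n. rodrigues_coeff (real n + p) (real n + q) n k * ((t - 1) / 2) ^ k"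
  have powr_cancel: "(1 - t) powr (- p) * (1 - t) powr p = 1" "(1 + t) powr (- q) * (1 + t) powr q = 1"
    using assms by (simp_all add: powr_minus)
  have "jacobi_P n p q t = (-1) ^ n / (2 ^ n * fact n) * (1 - t) powr (- p) * (1 + t) powr (- q) *
      ((-2) ^ n * ((1 - t) powr p * (1 + t) powr q) * ?Q)"
    unfolding jacobi_P_def using assms by (subst higher_deriv_jacobi_weight) auto
  also have "\<dots> = ((-1) ^ n * (-2) ^ n / 2 ^ n) * ((1 - t) powr (- p) * (1 - t) powr p)
      * ((1 + t) powr (- q) * (1 + t) powr q) * (?Q / fact n)"
    by (simp add: field_simps)
  also have "\<dots> = ?Q / fact n"
    unfolding powr_cancel by (simp add: power_mult_distrib[symmetric])
  also have "\<dots> = (\<Sum>k\<le>n. real (n choose k) * pochhammer (real n + p + q + 1) k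
      * pochhammer (p + 1 + real k) (n - k) / fact n * ((t - 1) / 2) ^ k)"
    unfolding sum_divide_distrib
    by (intro sum.cong refl) (simp add: rodrigues_coeff_def algebra_simps)
  finally show ?thesis .
qed

section \<open>A terminating very-well-poised sum\<close>

lemma add_of_nat_notin_nonpos_Ints:
  fixes z :: real
  assumes "z \<notin> \<int>\<^sub>\<le>\<^sub>0"
  shows "z + real i \<notin> \<int>\<^sub>\<le>\<^sub>0"
proof
  assume "z + real i \<in> \<int>\<^sub>\<le>\<^sub>0"
  then have "z + real i \<in> \<int>" "z + real i \<le> 0" by auto
  then have "z \<in> \<int>" "z \<le> 0"
    using Ints_diff[of "z + real i" "real i"] by auto
  then show False
    using assms by (simp add: nonpos_Ints_altdef)
qed

lemma pochhammer_shift_nonzero: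
  fixes z :: real
  assumes "z \<notin> \<int>\<^sub>\<le>\<^sub>0"
  shows "pochhammer (z + real i) n \<noteq> 0"
proof -
  have "pochhammer z (i + n) \<noteq> 0"
    using assms pochhammer_eq_0_imp_nonpos_Int by blast
  then show ?thesis
    by (simp add: pochhammer_product')
qed

text \<open>
  Up to normalisation this is the very-well-poised series
  \<open>4F3(c, 1 + c/2, d, -r; c/2, 1 + c - d, 1 + c + r; -1)\<close> with \<open>c = -(s + r)\<close>. For the summand \<open>F r m\<close>, the
  companion \<open>T m\<close> with \<open>F (r + 1) m - F r m = T m - T (m - 1)\<close> is found by matching the poles in \<open>m\<close> of
  the quotient of the left side by \<open>F r m\<close>. Since \<open>T\<close> vanishes beyond \<open>m = r\<close>, the sum does not depend
  on \<open>r\<close>, and it is 1 for \<open>r = 0\<close>. The assumption keeps every denominator away from 0.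
\<close>

lemma very_well_poised_sum:
  fixes d s :: real
  assumes "s - real r \<notin> \<int>\<^sub>\<le>\<^sub>0"
  shows "(\<Sum>m\<le>r. (-1) ^ m * real (r choose m) * pochhammer d m * pochhammer (s + d) (r - m)
           * (s + real r - 2 * real m) / pochhammer (s - real m) (Suc r)) = 1"
  using assms
proof (induction r)
  case 0
  then show ?case by auto
next
  case (Suc r)
  define F where "F r m = (-1) ^ m * real (r choose m) * pochhammer d m * pochhammer (s + d) (r - m)
           * (s + real r - 2 * real m) / pochhammer (s - real m) (Suc r)" for r m
  define T where "T m = (-1) ^ m * real (r choose m) * pochhammer d (Suc m) * pochhammer (s + d) (r - m)
           / pochhammer (s - real m) (Suc r)" for m
  have nz: "pochhammer (s - real m) n \<noteq> 0" if "m \<le> Suc r" for m n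
    using pochhammer_shift_nonzero[OF Suc.prems, of "Suc r - m" n] that by (simp add: of_nat_diff)
  have step0: "F (Suc r) 0 - F r 0 = T 0"
  proof -
    define D where "D = pochhammer s r"
    define W where "W = pochhammer (s + d) r"
    have nz': "D \<noteq> 0" "s + real r \<noteq> 0" "s + real r + 1 \<noteq> 0"
      using nz[of 0 "Suc (Suc r)"] by (auto simp: D_def pochhammer_Suc add_ac)
    have "F (Suc r) 0 = W * (s + d + real r) * (s + real r + 1) / (D * (s + real r) * (s + real r + 1))"
      by (simp add: F_def W_def D_def pochhammer_Suc add_ac)
    also have "\<dots> = W * (s + d + real r) / (D * (s + real r))"
      using nz' by simp
    finally have FS: "F (Suc r) 0 = W * (s + d + real r) / (D * (s + real r))" .
    have F: "F r 0 = W * (s + real r) / (D * (s + real r))"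
      by (simp add: F_def W_def D_def pochhammer_Suc)
    have T: "T 0 = d * W / (D * (s + real r))"
      by (simp add: T_def W_def D_def pochhammer_Suc)
    show ?thesis
      unfolding FS F T by (simp add: diff_divide_distrib[symmetric] algebra_simps)
  qed
  have step: "F (Suc r) (Suc m) - F r (Suc m) = T (Suc m) - T m" if "m \<le> r" for m
  proof -
    define x where "x = s - real (Suc m)"
    define D where "D = pochhammer (x + 1) r"
    define P where "P = (-1) ^ m * pochhammer d (Suc m)"
    define W where "W = pochhammer (s + d) (r - m)"
    define W' where "W' = pochhammer (s + d) (r - Suc m)"
    define A where "A = real (r choose m)"
    define B where "B = real (r choose Suc m)"
    have den1: "pochhammer (x + 1) (Suc r) = D * (x + real r + 1)"
      unfolding D_def pochhammer_Suc by (simp add: add_ac)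
    have den0: "pochhammer x (Suc r) = x * D"
      unfolding D_def pochhammer_rec ..
    have den2: "pochhammer x (Suc (Suc r)) = x * D * (x + real r + 1)"
      using pochhammer_rec[of x "Suc r"] unfolding den1 by simp
    have "x * D * (x + real r + 1) \<noteq> 0"
      using nz[of "Suc m" "Suc (Suc r)"] that by (simp add: den2 flip: x_def del: of_nat_Suc)
    then have nz': "x \<noteq> 0" "D \<noteq> 0" "x + real r + 1 \<noteq> 0" by auto
    have AB: "B * (real m + 1) = A * (real r - real m)"
      using binomial_absorb_comp[of r m] binomial_absorption[of m r] that
      unfolding A_def B_def by (metis of_nat_diff of_nat_mult mult.commute of_nat_Suc add.commute)
    \<comment> \<open>For \<open>m = r\<close> the truncated \<open>r - Suc m\<close> breaks the relation between \<open>W\<close> and \<open>W'\<close>, but then \<open>B = 0\<close>.\<close>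
    have BW: "B * W = B * (W' * (s + d + real r - real m - 1))"
    proof (cases "m < r")
      case True
      then have "r - m = Suc (r - Suc m)" "real (r - Suc m) = real r - real m - 1"
        by (simp_all add: of_nat_diff)
      then have "W = W' * (s + d + (real r - real m - 1))"
        by (simp add: W_def W'_def pochhammer_Suc)
      then show ?thesis by (simp add: add_diff_eq)
    qed (simp add: B_def)
    have FS: "F (Suc r) (Suc m) =
        - (P * ((A + B) * W * (s + real r - 1 - 2 * real m))) / (x * D * (x + real r + 1))"
      by (simp add: F_def den2 P_def A_def B_def W_def x_def[symmetric] del: of_nat_Suc)
         (simp add: algebra_simps)
    have F: "F r (Suc m) = - (P * (B * W' * (s + real r - 2 - 2 * real m))) / (x * D)"
      by (simp add: F_def den0 P_def B_def W'_def x_def[symmetric] del: of_nat_Suc)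
         (simp add: algebra_simps)
    have TS: "T (Suc m) = - (P * (B * W' * (d + real m + 1))) / (x * D)"
      by (simp add: T_def den0 P_def B_def W'_def pochhammer_Suc[of d "Suc m"] x_def[symmetric] del: of_nat_Suc)
    have "s - real m = x + 1" by (simp add: x_def)
    then have T: "T m = P * (A * W) / (D * (x + real r + 1))"
      by (simp add: T_def den1 P_def A_def W_def)
    have "(A + B) * W * (s + real r - 1 - 2 * real m) - A * W * x
        = (B * W) * (x + real r + 1)"
    proof -
      have "(A + B) * W * (s + real r - 1 - 2 * real m) - A * W * x
          = (A * (real r - real m)) * W + B * W * (s + real r - 1 - 2 * real m)"
        by (simp add: x_def algebra_simps)
      also have "\<dots> = (B * W) * (x + real r + 1)"
        unfolding AB[symmetric] by (simp add: x_def algebra_simps)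
      finally show ?thesis by simp
    qed
    then have key: "(A + B) * W * (s + real r - 1 - 2 * real m) - A * W * x
        = B * W' * (s + real r - 2 - 2 * real m) * (x + real r + 1) + B * W' * (d + real m + 1) * (x + real r + 1)"
      unfolding BW by (simp add: x_def algebra_simps)
    have "F (Suc r) (Suc m) + T m =
        - P * ((A + B) * W * (s + real r - 1 - 2 * real m) - A * W * x) / (x * D * (x + real r + 1))"
      unfolding FS T using nz' by (simp add: divide_simps) (simp add: algebra_simps)
    also have "\<dots> = - P * (B * W' * (s + real r - 2 - 2 * real m)
        + B * W' * (d + real m + 1)) / (x * D)"
      unfolding key using nz' by (simp add: divide_simps) (simp add: algebra_simps)
    also have "\<dots> = F r (Suc m) + T (Suc m)"
      unfolding F TS by (simp add: add_divide_distrib[symmetric] algebra_simps)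
    finally show ?thesis by simp
  qed
  have "s - real r \<notin> \<int>\<^sub>\<le>\<^sub>0"
    using add_of_nat_notin_nonpos_Ints[OF Suc.prems, of 1] by simp
  then have IH: "(\<Sum>m\<le>r. F r m) = 1"
    unfolding F_def by (rule Suc.IH)
  have "(\<Sum>m\<le>Suc r. F (Suc r) m - F r m) = T 0 + (\<Sum>m\<le>r. T (Suc m) - T m)"
    by (simp add: sum.atMost_Suc_shift step step0 del: sum.atMost_Suc)
  also have "\<dots> = T (Suc r)"
    using sum_lessThan_telescope[of T "Suc r"] by (simp add: lessThan_Suc_atMost)
  also have "\<dots> = 0" 
    by (simp add: T_def)
  finally have "(\<Sum>m\<le>Suc r. F (Suc r) m) = (\<Sum>m\<le>Suc r. F r m)"
    by (simp add: sum_subtractf)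
  also have "\<dots> = 1"
    using IH by (simp add: F_def)
  finally show ?case
    unfolding F_def .
qed


section \<open>The connection formula\<close>

text \<open>
  Coefficients of \<open>((t - 1) / 2)^k\<close> are compared for each \<open>k\<close>. In the \<open>m\<close>-th summand the symbols based
  at \<open>p + 1\<close> join up to \<open>pochhammer (p + 1 + k) (N - k)\<close>, and those based at \<open>N + p + \<alpha> + 1\<close> split off
  \<open>pochhammer (N + p + \<alpha> + 1) k\<close>; both are independent of \<open>m\<close> and belong to the coefficient on the left. What
  remains is \<open>very_well_poised_sum\<close>.
\<close>

lemma jacobi_P_connection_pochhammer:
  assumes "-1 < t" "t < 1" and "p + \<xi> + 1 \<notin> \<int>\<^sub>\<le>\<^sub>0"
  shows "jacobi_P N p \<alpha> t =
    (\<Sum>m\<le>N. (-1) ^ m * (2 * real N - 2 * real m + p + \<xi> + 1) * pochhammer (\<alpha> - \<xi>) m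
        * pochhammer (real N + p + \<alpha> + 1) (N - m) * pochhammer (p + 1 + real (N - m)) m
        / (fact m * pochhammer (real (N - m) + p + \<xi> + 1) (Suc N)) * jacobi_P (N - m) p \<xi> t)"
proof -
  define w where "w = (t - 1) / 2"
  define J where "J n q k = real (n choose k) * pochhammer (real n + p + q + 1) k
      * pochhammer (p + 1 + real k) (n - k) / fact n" for n q k
  define c where "c m = (-1) ^ m * (2 * real N - 2 * real m + p + \<xi> + 1) * pochhammer (\<alpha> - \<xi>) m
        * pochhammer (real N + p + \<alpha> + 1) (N - m) * pochhammer (p + 1 + real (N - m)) m
        / (fact m * pochhammer (real (N - m) + p + \<xi> + 1) (Suc N))" for m
  have jacobi: "jacobi_P n p q t = (\<Sum>k\<le>n. J n q k * w ^ k)" for n q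
    using assms by (simp add: jacobi_P_eq_sum J_def w_def)
  have coeff: "(\<Sum>m\<le>N. c m * J (N - m) \<xi> k) = J N \<alpha> k" if k: "k \<le> N" for k
  proof -
    define r where "r = N - k"
    \<comment> \<open>With these parameters each term on the left is the coefficient on the right times a
      summand of the very-well-poised sum; its poles are excluded because \<open>s - r\<close> is \<open>p + \<xi> + 1\<close> shifted up by \<open>2 k\<close>.\<close>
    define s where "s = real N + real k + p + \<xi> + 1"
    define d where "d = \<alpha> - \<xi>"
    have r: "real r = real N - real k"
      using k by (simp add: r_def of_nat_diff)
    have "s - real r = p + \<xi> + 1 + real (2 * k)"
      by (simp add: s_def r)
    then have s: "s - real r \<notin> \<int>\<^sub>\<le>\<^sub>0"
      using add_of_nat_notin_nonpos_Ints[OF assms(3), of "2 * k"] by metis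
    have summand: "c m * J (N - m) \<xi> k = J N \<alpha> k * ((-1) ^ m * real (r choose m) * pochhammer d m
        * pochhammer (s + d) (r - m) * (s + real r - 2 * real m) / pochhammer (s - real m) (Suc r))"
      if m: "m \<le> r" for m
    proof -
      have le: "m \<le> N" "k \<le> N - m" using m k by (auto simp: r_def)
      have Nm: "real (N - m) = real N - real m" using le by (simp add: of_nat_diff)
      define Z where "Z = pochhammer (real (N - m) + p + \<xi> + 1) k"
      have Z: "Z \<noteq> 0"
        using pochhammer_shift_nonzero[OF assms(3), of "N - m" k] by (simp add: Z_def add_ac)
      have "real (N - m) + p + \<xi> + 1 + real k = s - real m" "Suc N - k = Suc r"
        using k by (auto simp: Nm s_def r_def)
      then have e1: "pochhammer (real (N - m) + p + \<xi> + 1) (Suc N) = Z * pochhammer (s - real m) (Suc r)"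
        using pochhammer_product[of k "Suc N" "real (N - m) + p + \<xi> + 1"] k
        unfolding Z_def by simp
      have "real N + p + \<alpha> + 1 + real k = s + d" "N - m - k = r - m"
        using k m by (auto simp: s_def d_def r_def)
      then have e2: "pochhammer (real N + p + \<alpha> + 1) (N - m)
          = pochhammer (real N + p + \<alpha> + 1) k * pochhammer (s + d) (r - m)"
        using pochhammer_product[of k "N - m" "real N + p + \<alpha> + 1"] le by simp
      have "p + 1 + real k + real (N - m - k) = p + 1 + real (N - m)" "N - k - (N - m - k) = m"
        "N - m - k \<le> N - k"
        using le by (auto simp: of_nat_diff)
      then have e3: "pochhammer (p + 1 + real k) (N - m - k) * pochhammer (p + 1 + real (N - m)) m
          = pochhammer (p + 1 + real k) (N - k)"
        using pochhammer_product[of "N - m - k" "N - k" "p + 1 + real k"] by (simp only:)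
      have e4: "real (N - m choose k) / (fact m * fact (N - m))
          = real (N choose k) * real (r choose m) / fact N"
        using le k m by (simp add: binomial_fact r_def add.commute)
      have e5: "2 * real N - 2 * real m + p + \<xi> + 1 = s + real r - 2 * real m"
        by (simp add: s_def r)
      have "c m * J (N - m) \<xi> k = (-1) ^ m * (s + real r - 2 * real m) * pochhammer d m
          * (pochhammer (real N + p + \<alpha> + 1) k * pochhammer (s + d) (r - m))
          * (pochhammer (p + 1 + real k) (N - m - k) * pochhammer (p + 1 + real (N - m)) m)
          * (real (N - m choose k) / (fact m * fact (N - m)))
          * (Z / (Z * pochhammer (s - real m) (Suc r)))"
        unfolding c_def J_def e1 e2 e5 d_def[symmetric] Z_def[symmetric]
        by (simp add: mult_ac)
      also have "\<dots> = J N \<alpha> k * ((-1) ^ m * real (r choose m) * pochhammer d m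
        * pochhammer (s + d) (r - m) * (s + real r - 2 * real m) / pochhammer (s - real m) (Suc r))"
        unfolding e3 e4 J_def using Z by (simp add: mult_ac)
      finally show ?thesis .
    qed
    have "(\<Sum>m\<le>N. c m * J (N - m) \<xi> k) = (\<Sum>m\<le>r. c m * J (N - m) \<xi> k)"
      by (intro sum.mono_neutral_right) (auto simp: r_def J_def)
    also have "\<dots> = J N \<alpha> k * (\<Sum>m\<le>r. (-1) ^ m * real (r choose m) * pochhammer d m
        * pochhammer (s + d) (r - m) * (s + real r - 2 * real m) / pochhammer (s - real m) (Suc r))"
      unfolding sum_distrib_left by (intro sum.cong refl summand) simp
    also have "\<dots> = J N \<alpha> k"
      using very_well_poised_sum[OF s] by simp
    finally show ?thesis .
  qed
  have "(\<Sum>m\<le>N. c m * jacobi_P (N - m) p \<xi> t) = (\<Sum>m\<le>N. \<Sum>k\<le>N. c m * J (N - m) \<xi> k * w ^ k)"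
  proof (intro sum.cong refl)
    fix m
    have "jacobi_P (N - m) p \<xi> t = (\<Sum>k\<le>N. J (N - m) \<xi> k * w ^ k)"
      unfolding jacobi by (intro sum.mono_neutral_left) (auto simp: J_def)
    then show "c m * jacobi_P (N - m) p \<xi> t = (\<Sum>k\<le>N. c m * J (N - m) \<xi> k * w ^ k)"
      by (simp add: sum_distrib_left mult.assoc)
  qed
  also have "\<dots> = (\<Sum>k\<le>N. (\<Sum>m\<le>N. c m * J (N - m) \<xi> k) * w ^ k)"
    by (subst sum.swap) (simp add: sum_distrib_right)
  also have "\<dots> = jacobi_P N p \<alpha> t"
    by (simp add: coeff jacobi)
  finally show ?thesis
    by (simp add: c_def)
qed

text \<open>
  Each Pochhammer symbol of the previous lemma is a quotient of two Gamma values; the last three assumptions say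
  that none of the lower ones, and so none of those shifted up, is taken at a pole.
\<close>

lemma jacobi_P_connection:
  assumes "-1 < t" "t < 1"
    and "p + 1 \<notin> \<int>\<^sub>\<le>\<^sub>0" "p + \<xi> + 1 \<notin> \<int>\<^sub>\<le>\<^sub>0" "real N + p + \<alpha> + 1 \<notin> \<int>\<^sub>\<le>\<^sub>0"
  shows "jacobi_P N p \<alpha> t =
    (\<Sum>m\<le>N. ((-1) ^ m * (2 * real N - 2 * real m + p + \<xi> + 1)
          * Gamma (real N + p + 1) * pochhammer (\<alpha> - \<xi>) m)
       / (Gamma (real N + p + \<alpha> + 1) * Gamma (2 * real N - real m + p + \<xi> + 2))
       * ((Gamma (2 * real N - real m + p + \<alpha> + 1) * Gamma (real N - real m + p + \<xi> + 1))
          / (fact m * Gamma (real N - real m + p + 1)))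
       * jacobi_P (N - m) p \<xi> t)"
proof (subst jacobi_P_connection_pochhammer[OF assms(1,2,4)], intro sum.cong refl)
  fix m assume "m \<in> {..N}"
  then have m: "m \<le> N" and Nm: "real (N - m) = real N - real m"
    by (auto simp: of_nat_diff)
  have "pochhammer (p + 1 + real (N - m)) m = Gamma (real N + p + 1) / Gamma (real N - real m + p + 1)"
    using pochhammer_Gamma[OF add_of_nat_notin_nonpos_Ints[OF assms(3)], of "N - m" m]
    by (simp add: Nm algebra_simps)
  moreover have "pochhammer (real (N - m) + p + \<xi> + 1) (Suc N)
      = Gamma (2 * real N - real m + p + \<xi> + 2) / Gamma (real N - real m + p + \<xi> + 1)"
    using pochhammer_Gamma[OF add_of_nat_notin_nonpos_Ints[OF assms(4)], of "N - m" "Suc N"]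
    by (simp add: Nm algebra_simps)
  moreover have "pochhammer (real N + p + \<alpha> + 1) (N - m)
      = Gamma (2 * real N - real m + p + \<alpha> + 1) / Gamma (real N + p + \<alpha> + 1)"
    using pochhammer_Gamma[OF assms(5), of "N - m"]
    by (simp add: Nm algebra_simps)
  ultimately show "(-1) ^ m * (2 * real N - 2 * real m + p + \<xi> + 1) * pochhammer (\<alpha> - \<xi>) m
        * pochhammer (real N + p + \<alpha> + 1) (N - m) * pochhammer (p + 1 + real (N - m)) m
        / (fact m * pochhammer (real (N - m) + p + \<xi> + 1) (Suc N)) * jacobi_P (N - m) p \<xi> t =
      ((-1) ^ m * (2 * real N - 2 * real m + p + \<xi> + 1)
          * Gamma (real N + p + 1) * pochhammer (\<alpha> - \<xi>) m)
       / (Gamma (real N + p + \<alpha> + 1) * Gamma (2 * real N - real m + p + \<xi> + 2))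
       * ((Gamma (2 * real N - real m + p + \<alpha> + 1) * Gamma (real N - real m + p + \<xi> + 1))
          / (fact m * Gamma (real N - real m + p + 1)))
       * jacobi_P (N - m) p \<xi> t"
    by (simp add: mult_ac)
qed

section \<open>The six-parameter polynomials on the simplex\<close>

text \<open>
  Every Gamma argument of the statement is one of those in \<open>jacobi_P_connection\<close> once \<open>e\<close> and \<open>n\<close> are
  expressed through the first upper index \<open>p\<close>. The instance \<open>m = n1\<close> of the assumptions excludes poles at
  the smallest arguments \<open>p + 1\<close> and \<open>p + \<xi> + 1\<close>, and hence at all their shifts.
\<close>

theorem theorem3:
  fixes n1 n2 n3 n :: nat
    and \<alpha> \<beta> \<gamma> \<delta> a b \<xi> e x y z :: real
  assumes n: "n = n1 + n2 + n3"
    and e: "e = \<alpha> + \<beta> + \<gamma> + \<delta> + a + b"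
    and "real n + real n2 + real n3 + e - \<alpha> + 3 \<notin> \<int>\<^sub>\<le>\<^sub>0"
    and "real n + real n2 + real n3 + e + 3 \<notin> \<int>\<^sub>\<le>\<^sub>0"
    and "\<And>m. m \<le> n1 \<Longrightarrow> 2 * real n - real m + e - \<alpha> + \<xi> + 4 \<notin> \<int>\<^sub>\<le>\<^sub>0"
    and "\<And>m. m \<le> n1 \<Longrightarrow> 2 * real n - real m + e + 3 \<notin> \<int>\<^sub>\<le>\<^sub>0"
    and "\<And>m. m \<le> n1 \<Longrightarrow> real n + real n2 + real n3 - real m + e - \<alpha> + \<xi> + 3 \<notin> \<int>\<^sub>\<le>\<^sub>0"
    and "\<And>m. m \<le> n1 \<Longrightarrow> real n + real n2 + real n3 - real m + e - \<alpha> + 3 \<notin> \<int>\<^sub>\<le>\<^sub>0"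
    and "(x, y, z) \<in> simplex3"
  shows "P3 n1 n2 n3 \<alpha> \<beta> \<gamma> \<delta> a b x y z =
    (\<Sum>m = 0..n1.
       ((-1) ^ m * (2 * real n - 2 * real m + e - \<alpha> + \<xi> + 3)
          * Gamma (real n + real n2 + real n3 + e - \<alpha> + 3) * pochhammer (\<alpha> - \<xi>) m)
       / (Gamma (real n + real n2 + real n3 + e + 3)
          * Gamma (2 * real n - real m + e - \<alpha> + \<xi> + 4))
       * ((Gamma (2 * real n - real m + e + 3)
            * Gamma (real n + real n2 + real n3 - real m + e - \<alpha> + \<xi> + 3))
          / (fact m * Gamma (real n + real n2 + real n3 - real m + e - \<alpha> + 3)))
       * P3 (n1 - m) n2 n3 \<xi> \<beta> \<gamma> \<delta> a b x y z)"
proof -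
  define p where "p = \<beta> + \<gamma> + \<delta> + a + b + 2 * real n2 + 2 * real n3 + 2"
  define R where "R = (1 - x) ^ n2 * jacobi_P n2 (\<gamma> + \<delta> + 2 * real n3 + b + 1) \<beta> (2 * y / (1 - x) - 1)
      * (1 - x - y) ^ n3 * jacobi_P n3 \<delta> \<gamma> (2 * z / (1 - x - y) - 1)"
  have P3: "P3 k n2 n3 q \<beta> \<gamma> \<delta> a b x y z = jacobi_P k p q (2 * x - 1) * R" for k q
    by (simp add: P3_def p_def R_def)
  have t: "-1 < 2 * x - 1" "2 * x - 1 < 1"
    using assms(9) by (auto simp: simplex3_def)
  have args: "real n + real n2 + real n3 + e - \<alpha> + 3 = real n1 + p + 1"
    "real n + real n2 + real n3 + e + 3 = real n1 + p + \<alpha> + 1"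
    "\<And>m. 2 * real n - real m + e - \<alpha> + \<xi> + 4 = 2 * real n1 - real m + p + \<xi> + 2"
    "\<And>m. 2 * real n - real m + e + 3 = 2 * real n1 - real m + p + \<alpha> + 1"
    "\<And>m. real n + real n2 + real n3 - real m + e - \<alpha> + \<xi> + 3 = real n1 - real m + p + \<xi> + 1"
    "\<And>m. real n + real n2 + real n3 - real m + e - \<alpha> + 3 = real n1 - real m + p + 1"
    "\<And>m. 2 * real n - 2 * real m + e - \<alpha> + \<xi> + 3 = 2 * real n1 - 2 * real m + p + \<xi> + 1"
    by (simp_all add: n e p_def)
  have "p + 1 \<notin> \<int>\<^sub>\<le>\<^sub>0" "p + \<xi> + 1 \<notin> \<int>\<^sub>\<le>\<^sub>0" "real n1 + p + \<alpha> + 1 \<notin> \<int>\<^sub>\<le>\<^sub>0"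
    using assms(8)[of n1] assms(7)[of n1] assms(4) unfolding args by simp_all
  note connection = jacobi_P_connection[OF t this]
  show ?thesis
    unfolding args P3 by (subst connection) (simp add: sum_distrib_right atLeast0AtMost mult.assoc)
qed

end
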